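(* Let $G$ be a bipartite connected $d$-regular graph with edge connectivity $\kappa'<d$. If \[ \lambda_{\left\lceil\frac{d}{d-\kappa'}\right\rceil}(G) < d-\frac{d-1}{2d}, \] then $t(G)=1$.
   Context: All graphs are finite, undirected and simple. For a graph $G$ of order $n$, $\lambda_1(G)\ge\lambda_2(G)\ge\dots\ge\lambda_n(G)$ denote the eigenvalues of its adjacency matrix (with multiplicity). The edge connectivity of $G$ is denoted $\kappa'=\kappa'(G)$, and $c(H)$ denotes the number of components of a graph $H$. The toughness of a connected graph $G$ is $t(G)=\min\left\{\frac{|S|}{c(G-S)}\right\}$, where the minimum is taken over all proper subsets $S\subset V(G)$ such that $c(G-S)>1$. *)

theory Defs
  imports
    "HOL-Computational_Algebra.Polynomial"
    "Graph_Theory.Digraph_Component"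
    "Jordan_Normal_Form.Char_Poly"
begin

text \<open>
  A finite simple graph is a \<^locale>\<open>pair_graph\<close>: a finite vertex set with an irreflexive,
  symmetric set of ordered pairs, so each undirected edge occurs as two opposite arcs.
\<close>

definition bipartite :: "'a pair_pre_digraph \<Rightarrow> bool" where
  "bipartite G \<longleftrightarrow> (\<exists>X Y. X \<union> Y = pverts G \<and> X \<inter> Y = {} \<and>
     (\<forall>(u, v) \<in> parcs G. (u \<in> X \<and> v \<in> Y) \<or> (u \<in> Y \<and> v \<in> X)))"

definition regular :: "'a pair_pre_digraph \<Rightarrow> nat \<Rightarrow> bool" where
  "regular G d \<longleftrightarrow> (\<forall>v \<in> pverts G. out_degree (with_proj G) v = d)"

definition edges :: "'a pair_pre_digraph \<Rightarrow> 'a set set" where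
  "edges G = {{u, v} | u v. (u, v) \<in> parcs G}"

definition del_edges :: "'a pair_pre_digraph \<Rightarrow> 'a set set \<Rightarrow> 'a pair_pre_digraph" where
  "del_edges G F = \<lparr> pverts = pverts G, parcs = {(u, v) \<in> parcs G. {u, v} \<notin> F} \<rparr>"

text \<open>
  For a graph with at least two vertices the infimum is a minimum over a nonempty set.  On a
  single vertex no edge set disconnects, and \<open>Inf {} = 0\<close> gives the usual value 0.
\<close>

definition edge_connectivity :: "'a pair_pre_digraph \<Rightarrow> nat" where
  "edge_connectivity G =
     Inf {card F | F. F \<subseteq> edges G \<and> \<not> Digraph_Component.connected (with_proj (del_edges G F))}"

text \<open>In a symmetric digraph the strongly connected components are the components.\<close>

definition num_components :: "('a, 'b) pre_digraph \<Rightarrow> nat" where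
  "num_components H = card (pre_digraph.sccs_verts H)"

text \<open>
  The set is finite for finite \<open>G\<close>.  It is empty for complete graphs, whose toughness is
  therefore left unspecified.
\<close>

definition toughness :: "'a pair_pre_digraph \<Rightarrow> real" where
  "toughness G =
     Min {real (card S) / real (num_components (with_proj G \<restriction> (pverts G - S))) | S.
            S \<subset> pverts G \<and> num_components (with_proj G \<restriction> (pverts G - S)) > 1}"

definition adjacency_matrix :: "'a list \<Rightarrow> 'a pair_pre_digraph \<Rightarrow> real mat" where
  "adjacency_matrix vs G =
     mat (length vs) (length vs) (\<lambda>(i, j). if (vs ! i, vs ! j) \<in> parcs G then 1 else 0)"

text \<open>
  The eigenvalues in non-increasing order, repeated according to their multiplicity as roots of
  the characteristic polynomial.  They do not depend on the chosen enumeration of the vertices,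
  and there are \<open>card (pverts G)\<close> of them since the matrix is symmetric.
\<close>

definition adjacency_eigenvalues :: "'a pair_pre_digraph \<Rightarrow> real list" where
  "adjacency_eigenvalues G =
     rev (sorted_list_of_multiset (proots (char_poly
       (adjacency_matrix (SOME vs. distinct vs \<and> set vs = pverts G) G))))"

text \<open>Indices start at 1, so \<open>eigenvalue_nth G 1\<close> is the largest eigenvalue.\<close>

definition eigenvalue_nth :: "'a pair_pre_digraph \<Rightarrow> nat \<Rightarrow> real" where
  "eigenvalue_nth G k = adjacency_eigenvalues G ! (k - 1)"

end

theory Submission
  imports Defs "Jordan_Normal_Form.Spectral_Radius"
begin

text \<open>
  Deleting one colour class of a \<open>d\<close>-regular bipartite graph isolates the vertices of the other
  class, which has the same size, so the toughness is at most \<open>1\<close>.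

  For the converse, suppose that deleting \<open>S\<close> leaves \<open>c > |S|\<close> components.  At most
  \<open>d |S| \<le> d (c - 1)\<close> edges join \<open>S\<close> to the components, while each component sends at least
  \<open>\<kappa>'\<close> edges to \<open>S\<close>.  Comparing with \<open>d\<close> edges per component shows that at least
  \<open>\<lceil>d / (d - \<kappa>')\<rceil>\<close> components send fewer than \<open>d\<close> edges to \<open>S\<close>
  (\<open>many_small_boundaries\<close>).  In a bipartite \<open>d\<close>-regular graph a nonempty vertex set with so small
  a boundary has at least \<open>2 d\<close> vertices (\<open>small_boundary_card_ge\<close>), hence induces a subgraph of
  average degree at least \<open>d - (d - 1) / (2 d)\<close>.  No edge joins two components, so the indicator
  vectors of these components span a space on which the Rayleigh quotient of the adjacency matrix
  is at least this number (\<open>eigenvalue_nth_ge_of_separated_sets\<close>).  By the Courant-Fischer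
  principle (\<open>count_eigenvalues_ge\<close>) the eigenvalue with index \<open>\<lceil>d / (d - \<kappa>')\<rceil>\<close> is at least
  \<open>d - (d - 1) / (2 d)\<close>, contrary to the hypothesis.

  The Courant-Fischer principle rests on the orthogonal diagonalisation of real symmetric matrices
  (\<open>real_spectral_theorem\<close>), which also identifies the roots of the characteristic polynomial,
  with multiplicity, with the diagonal entries.
\<close>

section \<open>Diagonalisation of real symmetric matrices\<close>

text \<open>
  A complex eigenvector \<open>z\<close> exists because the characteristic polynomial has a complex root.  The
  Hermitian form \<open>z\<^sup>* A z\<close> is a real number and equals the eigenvalue times the positive number
  \<open>z\<^sup>* z\<close>, so the eigenvalue is real.
\<close>

lemma real_symmetric_unit_eigenvector:
  fixes A :: "real mat"
  assumes A: "A \<in> carrier_mat n n" and sym: "transpose_mat A = A" and n: "n > 0"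
  obtains e v where "v \<in> carrier_vec n" "v \<bullet> v = 1" "A *\<^sub>v v = e \<cdot>\<^sub>v v"
proof -
  let ?C = "map_mat complex_of_real A"
  have C: "?C \<in> carrier_mat n n" using A by simp
  have A_sym: "A $$ (i, j) = A $$ (j, i)" if "i < n" "j < n" for i j
    using that A sym index_transpose_mat(1)[of j A i] by auto
  obtain w z where ev: "eigenvector ?C z w"
    using spectrum_non_empty[OF C n] unfolding spectrum_def eigenvalue_def by auto
  then have z: "z \<in> carrier_vec n" "z \<noteq> 0\<^sub>v n" "?C *\<^sub>v z = w \<cdot>\<^sub>v z"
    using C unfolding eigenvector_def by auto
  have row: "(\<Sum>j<n. of_real (A $$ (i, j)) * z $ j) = w * z $ i" if "i < n" for i
    using arg_cong[OF z(3), of "\<lambda>v. v $ i"] that z(1) A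
    by (simp add: scalar_prod_def lessThan_atLeast0)
  define N where "N = (\<Sum>i<n. (cmod (z $ i))\<^sup>2)"
  have quad: "(\<Sum>i<n. cnj (z $ i) * (\<Sum>j<n. of_real (A $$ (i, j)) * z $ j)) = w * of_real N"
  proof -
    have "cnj (z $ i) * (w * z $ i) = w * of_real ((cmod (z $ i))\<^sup>2)" for i
      by (subst complex_norm_square) (simp add: algebra_simps)
    then have "(\<Sum>i<n. cnj (z $ i) * (w * z $ i)) = w * of_real N"
      unfolding N_def of_real_sum sum_distrib_left by (intro sum.cong) auto
    then show ?thesis by (simp add: row)
  qed
  \<comment> \<open>The Hermitian form is its own conjugate, because exchanging the two summation indices
    turns one into the other.\<close>
  have "cnj (w * of_real N) = w * of_real N"
  proof -
    have "cnj (w * of_real N)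
        = (\<Sum>i<n. \<Sum>j<n. z $ i * of_real (A $$ (i, j)) * cnj (z $ j))"
      unfolding quad[symmetric] by (simp add: sum_distrib_left mult.assoc)
    also have "\<dots> = (\<Sum>j<n. \<Sum>i<n. z $ i * of_real (A $$ (i, j)) * cnj (z $ j))"
      by (rule sum.swap)
    also have "\<dots> = (\<Sum>j<n. cnj (z $ j) * (\<Sum>i<n. of_real (A $$ (j, i)) * z $ i))"
      by (simp add: sum_distrib_left A_sym mult_ac)
    finally show ?thesis unfolding quad .
  qed
  moreover have "N \<noteq> 0"
  proof
    assume "N = 0"
    then have "\<forall>i<n. z $ i = 0"
      unfolding N_def by (subst (asm) sum_nonneg_eq_0_iff) auto
    with z(1,2) show False by auto
  qed
  ultimately have "Im w = 0"
    by (simp add: complex_eq_iff)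
  then have w: "w = of_real (Re w)" by (simp add: complex_eq_iff)
  \<comment> \<open>As the eigenvalue is real, both the real and the imaginary part of \<open>z\<close> satisfy the
    eigenvalue equation.\<close>
  have parts: "A *\<^sub>v map_vec Re z = Re w \<cdot>\<^sub>v map_vec Re z" "A *\<^sub>v map_vec Im z = Re w \<cdot>\<^sub>v map_vec Im z"
  proof -
    show "A *\<^sub>v map_vec Re z = Re w \<cdot>\<^sub>v map_vec Re z"
    proof (rule eq_vecI)
      fix i assume "i < dim_vec (Re w \<cdot>\<^sub>v map_vec Re z)"
      then have i: "i < n" using z(1) by simp
      show "(A *\<^sub>v map_vec Re z) $ i = (Re w \<cdot>\<^sub>v map_vec Re z) $ i"
        using arg_cong[OF row[OF i], of Re] i z(1) A \<open>Im w = 0\<close>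
        by (simp add: scalar_prod_def lessThan_atLeast0)
    qed (use A z(1) in auto)
    show "A *\<^sub>v map_vec Im z = Re w \<cdot>\<^sub>v map_vec Im z"
    proof (rule eq_vecI)
      fix i assume "i < dim_vec (Re w \<cdot>\<^sub>v map_vec Im z)"
      then have i: "i < n" using z(1) by simp
      show "(A *\<^sub>v map_vec Im z) $ i = (Re w \<cdot>\<^sub>v map_vec Im z) $ i"
        using arg_cong[OF row[OF i], of Im] i z(1) A \<open>Im w = 0\<close>
        by (simp add: scalar_prod_def lessThan_atLeast0)
    qed (use A z(1) in auto)
  qed
  have "map_vec Re z \<noteq> 0\<^sub>v n \<or> map_vec Im z \<noteq> 0\<^sub>v n"
  proof (rule ccontr)
    assume "\<not> ?thesis"
    then have eq: "map_vec Re z = 0\<^sub>v n" "map_vec Im z = 0\<^sub>v n" by auto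
    have "z = 0\<^sub>v n"
    proof (rule eq_vecI)
      fix i assume "i < dim_vec (0\<^sub>v n :: complex vec)"
      then show "z $ i = 0\<^sub>v n $ i"
        using arg_cong[OF eq(1), of "\<lambda>v. v $ i"] arg_cong[OF eq(2), of "\<lambda>v. v $ i"] z(1)
        by (simp add: complex_eq_iff)
    qed (use z(1) in auto)
    with z(2) show False by simp
  qed
  with parts z(1) obtain u where u: "u \<in> carrier_vec n" "u \<noteq> 0\<^sub>v n" "A *\<^sub>v u = Re w \<cdot>\<^sub>v u"
    by (metis map_carrier_vec)
  have pos: "u \<bullet> u > 0"
    using conjugate_square_greater_0_vec[OF u(1)] u(2) by simp
  define c where "c = 1 / sqrt (u \<bullet> u)"
  show thesis
  proof
    show "c \<cdot>\<^sub>v u \<in> carrier_vec n" using u by simp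
    show "(c \<cdot>\<^sub>v u) \<bullet> (c \<cdot>\<^sub>v u) = 1"
      using u(1) pos by (simp add: c_def)
    show "A *\<^sub>v (c \<cdot>\<^sub>v u) = Re w \<cdot>\<^sub>v (c \<cdot>\<^sub>v u)"
      using u A by (simp add: mult_mat_vec smult_smult_assoc mult.commute)
  qed
qed

text \<open>
  The matrix is the reflection in the hyperplane orthogonal to \<open>w = v - e\<^sub>0\<close>, that is
  \<open>U = 1 - 2 w w\<^sup>T / (w\<^sup>T w)\<close>, which exchanges \<open>e\<^sub>0\<close> and the unit vector \<open>v\<close>.  Since
  \<open>w\<^sup>T w = 2 (1 - v\<^sub>0)\<close>, the coefficient is \<open>1 / (1 - v\<^sub>0)\<close>.  In the degenerate case \<open>v = e\<^sub>0\<close>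
  the convention \<open>1 / 0 = 0\<close> turns the formula into the identity matrix, as it should be.
\<close>

lemma householder_reflection:
  fixes v :: "real vec"
  assumes v: "v \<in> carrier_vec n" "v \<bullet> v = 1" and n: "n > 0"
  obtains U where "U \<in> carrier_mat n n" "transpose_mat U = U" "U * U = 1\<^sub>m n" "col U 0 = v"
proof -
  define \<delta> :: "nat \<Rightarrow> nat \<Rightarrow> real" where "\<delta> i j = (if i = j then 1 else 0)" for i j
  define w where "w i = v $ i - \<delta> i 0" for i
  define c where "c = 1 / (1 - v $ 0)"
  have vv: "(\<Sum>i<n. v $ i * v $ i) = 1"
    using v by (simp add: scalar_prod_def lessThan_atLeast0)
  have ww: "(\<Sum>i<n. w i * w i) = 2 * (1 - v $ 0)"
  proof -
    have "w i * w i = v $ i * v $ i + (if i = 0 then 1 - 2 * v $ 0 else 0)" for i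
      by (auto simp: w_def \<delta>_def algebra_simps)
    then show ?thesis using n by (simp add: sum.distrib vv)
  qed
  have w0: "w i = 0" if "v $ 0 = 1" "i < n" for i
  proof -
    have "(\<Sum>i<n. w i * w i) = 0" using ww that by simp
    then show ?thesis using that by (subst (asm) sum_nonneg_eq_0_iff) auto
  qed
  define U where "U = mat n n (\<lambda>(i, j). \<delta> i j - c * w i * w j)"
  show thesis
  proof
    show U: "U \<in> carrier_mat n n" by (simp add: U_def)
    show "transpose_mat U = U" by (rule eq_matI) (auto simp: U_def \<delta>_def)
    show "U * U = 1\<^sub>m n"
    proof (rule eq_matI)
      fix i j assume "i < dim_row (1\<^sub>m n :: real mat)" "j < dim_col (1\<^sub>m n :: real mat)"
      then have ij: "i < n" "j < n" by auto
      have "(U * U) $$ (i, j) = (\<Sum>k<n. (\<delta> i k - c * w i * w k) * (\<delta> k j - c * w k * w j))"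
        using ij by (simp add: U_def scalar_prod_def lessThan_atLeast0)
      also have "\<dots> = (\<Sum>k<n. (if k = i then \<delta> i j - c * w i * w j else 0)
          - (if k = j then c * w i * w j else 0) + c\<^sup>2 * w i * w j * (w k * w k))"
        by (intro sum.cong) (auto simp: \<delta>_def algebra_simps power2_eq_square)
      also have "\<dots> = \<delta> i j - c * w i * w j - c * w i * w j
          + c\<^sup>2 * w i * w j * (2 * (1 - v $ 0))"
        using ij by (simp add: sum.distrib sum_subtractf sum_distrib_left[symmetric] ww)
      also have "\<dots> = \<delta> i j + 2 * w i * w j * (c\<^sup>2 * (1 - v $ 0) - c)"
        by (simp add: algebra_simps)
      also have "c\<^sup>2 * (1 - v $ 0) = c"
        by (simp add: c_def power2_eq_square)
      finally show "(U * U) $$ (i, j) = 1\<^sub>m n $$ (i, j)" using ij by (simp add: \<delta>_def)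
    qed (auto simp: U_def)
    show "col U 0 = v"
    proof (rule eq_vecI)
      fix i assume "i < dim_vec v"
      then have i: "i < n" using v by simp
      have "w i = - (c * w i * w 0)"
      proof (cases "v $ 0 = 1")
        case True
        then show ?thesis using w0 i by simp
      next
        case False
        then show ?thesis by (simp add: c_def w_def \<delta>_def field_simps)
      qed
      then show "col U 0 $ i = v $ i" using i n by (simp add: U_def) (simp add: w_def)
    qed (use v in \<open>auto simp: U_def\<close>)
  qed
qed

text \<open>
  Induction on the size.  A Householder reflection \<open>U\<close> whose first column is a unit eigenvector
  turns \<open>A\<close> into \<open>U A U\<close>, whose first column is a multiple of \<open>e\<^sub>0\<close>; by symmetry so is its first
  row.  Hence \<open>U A U\<close> is block diagonal and the induction hypothesis applies to the symmetric
  lower right block.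
\<close>

lemma real_spectral_theorem:
  fixes A :: "real mat"
  assumes "A \<in> carrier_mat n n" and "transpose_mat A = A"
  shows "\<exists>P D. P \<in> carrier_mat n n \<and> D \<in> carrier_mat n n \<and> diagonal_mat D \<and>
    transpose_mat P * P = 1\<^sub>m n \<and> A = P * D * transpose_mat P"
  using assms
proof (induction n arbitrary: A)
  case 0
  then show ?case
    by (intro exI[of _ "0\<^sub>m 0 0"]) (auto simp: diagonal_mat_def)
next
  case (Suc n)
  obtain e v where v: "v \<in> carrier_vec (Suc n)" "v \<bullet> v = 1" "A *\<^sub>v v = e \<cdot>\<^sub>v v"
    using real_symmetric_unit_eigenvector[OF Suc.prems zero_less_Suc] by blast
  obtain U where U: "U \<in> carrier_mat (Suc n) (Suc n)" "transpose_mat U = U"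
    "U * U = 1\<^sub>m (Suc n)" "col U 0 = v"
    using householder_reflection[OF v(1,2)] by auto
  define B where "B = U * A * U"
  have B: "B \<in> carrier_mat (Suc n) (Suc n)" unfolding B_def using U Suc.prems by simp
  have A_eq: "A = U * B * U"
  proof -
    have "U * B * U = (U * U) * A * (U * U)"
      unfolding B_def using U(1) Suc.prems(1) by (simp add: assoc_mult_mat[of _ "Suc n" "Suc n" _ "Suc n" _ "Suc n"])
    then show ?thesis using U Suc.prems by simp
  qed
  have B_sym: "transpose_mat B = B"
  proof -
    have "transpose_mat B = U * (A * U)"
      unfolding B_def using U Suc.prems
      by (simp add: transpose_mult[of _ "Suc n" "Suc n" _ "Suc n"])
    then show ?thesis unfolding B_def using U(1) Suc.prems by simp
  qed
  have B_swap: "B $$ (i, j) = B $$ (j, i)" if "i < Suc n" "j < Suc n" for i j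
    using that B B_sym index_transpose_mat(1)[of j B i] by auto
  have col0: "B $$ (i, 0) = (if i = 0 then e else 0)" if i: "i < Suc n" for i
  proof -
    have "col B 0 = (U * A) *\<^sub>v col U 0"
      unfolding B_def by (rule col_mult2[of _ "Suc n" "Suc n" _ "Suc n"]) (use U Suc.prems in auto)
    also have "\<dots> = U *\<^sub>v (A *\<^sub>v v)"
      unfolding U(4) using U(1) Suc.prems(1) v(1) by (rule assoc_mult_mat_vec)
    also have "\<dots> = e \<cdot>\<^sub>v (U *\<^sub>v v)"
      unfolding v(3) using U(1) v(1) by (rule mult_mat_vec)
    also have "U *\<^sub>v v = col (U * U) 0"
      unfolding U(4)[symmetric] by (rule col_mult2[of _ "Suc n" "Suc n" _ "Suc n", symmetric]) (use U in auto)
    finally have "col B 0 $ i = (e \<cdot>\<^sub>v col (1\<^sub>m (Suc n)) 0) $ i" unfolding U(3) by simp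
    then show ?thesis using B i by simp
  qed
  define C where "C = mat n n (\<lambda>(i, j). B $$ (Suc i, Suc j))"
  have C: "C \<in> carrier_mat n n" by (simp add: C_def)
  have C_sym: "transpose_mat C = C"
    by (rule eq_matI) (auto simp: C_def B_swap)
  have B_block: "B = four_block_mat (mat 1 1 (\<lambda>_. e)) (0\<^sub>m 1 n) (0\<^sub>m n 1) C"
  proof (rule eq_matI)
    fix i j
    assume "i < dim_row (four_block_mat (mat 1 1 (\<lambda>_. e)) (0\<^sub>m 1 n) (0\<^sub>m n 1) C)"
      "j < dim_col (four_block_mat (mat 1 1 (\<lambda>_. e)) (0\<^sub>m 1 n) (0\<^sub>m n 1) C)"
    then have ij: "i < Suc n" "j < Suc n" using C by auto
    then show "B $$ (i, j) = four_block_mat (mat 1 1 (\<lambda>_. e)) (0\<^sub>m 1 n) (0\<^sub>m n 1) C $$ (i, j)"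
      using col0[of i] col0[of j] B_swap[OF ij] C
      by (cases i; cases j) (auto simp: C_def)
  qed (use B C in auto)
  obtain Q D where Q: "Q \<in> carrier_mat n n" and D: "D \<in> carrier_mat n n" "diagonal_mat D"
    and Q_orth: "transpose_mat Q * Q = 1\<^sub>m n" and C_eq: "C = Q * D * transpose_mat Q"
    using Suc.IH[OF C C_sym] by blast
  define R where "R = four_block_mat (1\<^sub>m 1) (0\<^sub>m 1 n) (0\<^sub>m n 1) Q"
  define E where "E = four_block_mat (mat 1 1 (\<lambda>_. e)) (0\<^sub>m 1 n) (0\<^sub>m n 1) D"
  have R: "R \<in> carrier_mat (Suc n) (Suc n)" and E: "E \<in> carrier_mat (Suc n) (Suc n)"
    unfolding R_def E_def using Q D by auto
  have RT: "transpose_mat R = four_block_mat (1\<^sub>m 1) (0\<^sub>m 1 n) (0\<^sub>m n 1) (transpose_mat Q)"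
    unfolding R_def using Q by (subst transpose_four_block_mat[of _ 1 1 _ n _ n]) auto
  have R_orth: "transpose_mat R * R = 1\<^sub>m (Suc n)"
    unfolding RT unfolding R_def using Q Q_orth
    by (subst mult_four_block_mat[of _ 1 1 _ n _ n _ _ 1 _ n]) auto
  have B_eq: "B = R * E * transpose_mat R"
  proof -
    have "R * E = four_block_mat (mat 1 1 (\<lambda>_. e)) (0\<^sub>m 1 n) (0\<^sub>m n 1) (Q * D)"
      unfolding R_def E_def using Q D
      by (subst mult_four_block_mat[of _ 1 1 _ n _ n _ _ 1 _ n]) auto
    then show ?thesis
      unfolding RT B_block C_eq using Q D
      by (simp add: mult_four_block_mat[of _ 1 1 _ n _ n _ _ 1 _ n])
  qed
  have UT: "transpose_mat (U * R) = transpose_mat R * U"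
    using U R by (simp add: transpose_mult[of _ "Suc n" "Suc n" _ "Suc n"])
  show ?case
  proof (intro exI conjI)
    show "U * R \<in> carrier_mat (Suc n) (Suc n)" using U R by simp
    show "E \<in> carrier_mat (Suc n) (Suc n)" by (rule E)
    show "diagonal_mat E"
      using D unfolding diagonal_mat_def E_def by auto
    have "transpose_mat R * U * (U * R) = transpose_mat R * ((U * U) * R)"
      using U(1) R by (simp add: assoc_mult_mat[of _ "Suc n" "Suc n" _ "Suc n" _ "Suc n"])
    then show "transpose_mat (U * R) * (U * R) = 1\<^sub>m (Suc n)"
      unfolding UT using U R R_orth by simp
    have "U * (R * E * transpose_mat R) * U = U * R * E * (transpose_mat R * U)"
      using U(1) R E by (simp add: assoc_mult_mat[of _ "Suc n" "Suc n" _ "Suc n" _ "Suc n"])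
    then show "A = U * R * E * transpose_mat (U * R)"
      unfolding UT using A_eq B_eq by simp
  qed
qed

section \<open>Eigenvalues bounded below by a subspace\<close>

text \<open>
  Padding the fewer than \<open>k\<close> equations with zero rows gives a square matrix with a zero row, hence
  with determinant zero and a nontrivial kernel.
\<close>

lemma underdetermined_homogeneous_system:
  fixes f :: "'i \<Rightarrow> real vec"
  assumes "finite I" and "card I < k" and f: "\<And>i. i \<in> I \<Longrightarrow> f i \<in> carrier_vec k"
  obtains c where "c \<in> carrier_vec k" "c \<noteq> 0\<^sub>v k" "\<And>i. i \<in> I \<Longrightarrow> f i \<bullet> c = 0"
proof -
  obtain g where g: "bij_betw g {0..<card I} I"
    using ex_bij_betw_nat_finite[OF \<open>finite I\<close>] by blast
  define r where "r i = (if i < card I then f (g i) else 0\<^sub>v k)" for i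
  have r: "r i \<in> carrier_vec k" for i
    using f g by (auto simp: r_def dest: bij_betwE)
  define M where "M = mat\<^sub>r k k (\<lambda>i. if i = k - 1 then 0\<^sub>v k else r i)"
  have "det M = 0"
    unfolding M_def using \<open>card I < k\<close> r by (intro det_row_0) auto
  moreover have M: "M \<in> carrier_mat k k" by (simp add: M_def)
  ultimately obtain c where c: "c \<in> carrier_vec k" "c \<noteq> 0\<^sub>v k" "M *\<^sub>v c = 0\<^sub>v k"
    using det_0_iff_vec_prod_zero[OF M] by auto
  show thesis
  proof
    fix i assume "i \<in> I"
    then obtain j where j: "j < card I" "i = g j"
      using g by (metis atLeastLessThan_iff bij_betw_iff_bijections)
    have row: "row M j = f i"
    proof (cases "j = k - 1")
      case True
      then show ?thesis using j \<open>card I < k\<close> by simp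
    next
      case False
      then show ?thesis using j \<open>card I < k\<close> r[of j] unfolding M_def by (auto simp: r_def)
    qed
    show "f i \<bullet> c = 0"
      using arg_cong[OF c(3), of "\<lambda>v. v $ j"] j \<open>card I < k\<close> M by (simp add: row)
  qed (rule c(1), rule c(2))
qed

lemma proots_prod_linear_factors:
  fixes xs :: "'a :: idom list"
  shows "proots (\<Prod>a\<leftarrow>xs. [:- a, 1:]) = mset xs"
proof (induction xs)
  case (Cons a xs)
  have "(\<Prod>a\<leftarrow>xs. [:- a, 1:]) \<noteq> 0" by (auto simp: prod_list_zero_iff)
  then have "proots ([:- a, 1:] * (\<Prod>a\<leftarrow>xs. [:- a, 1:])) = {#a#} + mset xs"
    using Cons by (subst proots_mult) auto
  then show ?case by simp
qed simp

text \<open>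
  One half of the Courant-Fischer principle: if the Rayleigh quotient of \<open>A\<close> is at least \<open>\<theta>\<close> on
  a \<open>k\<close>-dimensional space, here the column space of \<open>W\<close>, then at least \<open>k\<close> eigenvalues are at
  least \<open>\<theta>\<close>.  Otherwise the space contains a nonzero vector orthogonal to the fewer than \<open>k\<close>
  eigenvectors with eigenvalue at least \<open>\<theta>\<close>.  Such a vector is a combination of eigenvectors with
  eigenvalue below \<open>\<theta>\<close>, so its Rayleigh quotient is below \<open>\<theta>\<close>.
\<close>

lemma count_eigenvalues_ge:
  fixes A :: "real mat"
  assumes A: "A \<in> carrier_mat n n" and sym: "transpose_mat A = A"
    and W: "W \<in> carrier_mat n k"
    and inj: "\<And>c. c \<in> carrier_vec k \<Longrightarrow> c \<noteq> 0\<^sub>v k \<Longrightarrow> W *\<^sub>v c \<noteq> 0\<^sub>v n"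
    and ge: "\<And>c. c \<in> carrier_vec k \<Longrightarrow>
      \<theta> * ((W *\<^sub>v c) \<bullet> (W *\<^sub>v c)) \<le> (W *\<^sub>v c) \<bullet> (A *\<^sub>v (W *\<^sub>v c))"
  shows "k \<le> size {#x \<in># proots (char_poly A). \<theta> \<le> x#}"
proof -
  obtain P D where P: "P \<in> carrier_mat n n" and D: "D \<in> carrier_mat n n" "diagonal_mat D"
    and PTP: "transpose_mat P * P = 1\<^sub>m n" and A_eq: "A = P * D * transpose_mat P"
    using real_spectral_theorem[OF A sym] by blast
  have PPT: "P * transpose_mat P = 1\<^sub>m n"
    using mat_mult_left_right_inverse[OF _ P PTP] P by simp
  have "similar_mat A D"
    by (rule similar_matI[of _ _ P "transpose_mat P" n]) (use A P D PTP PPT A_eq in auto)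
  moreover have "upper_triangular D"
    using D unfolding diagonal_mat_def by auto
  ultimately have "proots (char_poly A) = mset (diag_mat D)"
    using char_poly_similar char_poly_upper_triangular[OF D(1)] proots_prod_linear_factors
    by metis
  then have count: "size {#x \<in># proots (char_poly A). \<theta> \<le> x#} = card {i. i < n \<and> \<theta> \<le> D $$ (i, i)}"
    using D(1) unfolding \<open>proots (char_poly A) = mset (diag_mat D)\<close> mset_filter[symmetric]
    by (simp add: length_filter_conv_card diag_mat_def cong: conj_cong del: mset_filter)
  show ?thesis
  proof (rule ccontr)
    define I where "I = {i. i < n \<and> \<theta> \<le> D $$ (i, i)}"
    assume "\<not> ?thesis"
    then have "card I < k" unfolding count I_def by simp
    moreover have "finite I" by (simp add: I_def)
    moreover have "row (transpose_mat P * W) i \<in> carrier_vec k" if "i \<in> I" for i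
      using W by (intro carrier_vecI) simp
    ultimately obtain c where c: "c \<in> carrier_vec k" "c \<noteq> 0\<^sub>v k"
      and orth: "\<And>i. i \<in> I \<Longrightarrow> row (transpose_mat P * W) i \<bullet> c = 0"
      using underdetermined_homogeneous_system by blast
    \<comment> \<open>\<open>y\<close> is the coordinate vector of \<open>x\<close> in the orthonormal basis of eigenvectors.\<close>
    define x where "x = W *\<^sub>v c"
    define y where "y = transpose_mat P *\<^sub>v x"
    have x: "x \<in> carrier_vec n" and y: "y \<in> carrier_vec n"
      using W c P by (auto simp: x_def y_def)
    have y_I: "y $ i = 0" if "i \<in> I" for i
    proof -
      have "y = (transpose_mat P * W) *\<^sub>v c"
        unfolding y_def x_def using P W c by (simp add: assoc_mult_mat_vec[of _ n n _ k])
      then show ?thesis using orth[OF that] that P by (simp add: I_def)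
    qed
    have x_eq: "x = P *\<^sub>v y"
      unfolding y_def using P x PPT by (simp flip: assoc_mult_mat_vec[of P n n _ n])
    have pull: "x \<bullet> (P *\<^sub>v z) = y \<bullet> z" if "z \<in> carrier_vec n" for z
      using transpose_vec_mult_scalar[OF P that x] by (simp add: y_def)
    have "x \<bullet> x = y \<bullet> y"
      using pull[OF y] x_eq by simp
    then have norm: "x \<bullet> x = (\<Sum>i<n. (y $ i)\<^sup>2)"
      using y by (simp add: scalar_prod_def lessThan_atLeast0 power2_eq_square)
    have "A *\<^sub>v x = P *\<^sub>v (D *\<^sub>v y)"
      unfolding A_eq y_def using P D x by (simp add: assoc_mult_mat_vec[of _ n n _ n])
    then have "x \<bullet> (A *\<^sub>v x) = y \<bullet> (D *\<^sub>v y)"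
      using pull D y by simp
    moreover have "(D *\<^sub>v y) $ i = D $$ (i, i) * y $ i" if "i < n" for i
    proof -
      have "(D *\<^sub>v y) $ i = (\<Sum>j<n. D $$ (i, j) * y $ j)"
        using that D y by (simp add: scalar_prod_def lessThan_atLeast0)
      also have "\<dots> = (\<Sum>j<n. if j = i then D $$ (i, i) * y $ i else 0)"
        using that D by (intro sum.cong) (auto simp: diagonal_mat_def)
      finally show ?thesis using that by simp
    qed
    ultimately have quad: "x \<bullet> (A *\<^sub>v x) = (\<Sum>i<n. D $$ (i, i) * (y $ i)\<^sup>2)"
      using y D by (simp add: scalar_prod_def lessThan_atLeast0 power2_eq_square mult_ac)
    have "x \<noteq> 0\<^sub>v n" unfolding x_def by (rule inj[OF c])
    then have "x \<bullet> x > 0"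
      using conjugate_square_greater_0_vec[OF x] by simp
    then obtain m where m: "m < n" "y $ m \<noteq> 0"
      unfolding norm by (metis (mono_tags, lifting) lessThan_iff less_irrefl sum.neutral zero_power2)
    have le: "D $$ (i, i) * (y $ i)\<^sup>2 \<le> \<theta> * (y $ i)\<^sup>2" if "i < n" for i
      using y_I[of i] that by (cases "i \<in> I") (auto simp: I_def intro!: mult_right_mono)
    have "D $$ (m, m) < \<theta>"
      using y_I[of m] m by (force simp: I_def not_le)
    then have "D $$ (m, m) * (y $ m)\<^sup>2 < \<theta> * (y $ m)\<^sup>2"
      using m by (intro mult_strict_right_mono) auto
    then have "x \<bullet> (A *\<^sub>v x) < \<theta> * (x \<bullet> x)"
      unfolding quad norm sum_distrib_left using le m(1)
      by (intro sum_strict_mono_ex1 bexI[of _ m]) auto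
    with ge[OF c(1)] show False by (simp add: x_def)
  qed
qed

lemma nth_rev_sorted_list_of_multiset_ge:
  assumes "0 < k" and "k \<le> size {#x \<in># M. \<theta> \<le> x#}"
  shows "\<theta> \<le> rev (sorted_list_of_multiset M) ! (k - 1)"
proof (rule ccontr)
  define xs where "xs = rev (sorted_list_of_multiset M)"
  have mset: "mset xs = M" by (simp add: xs_def)
  assume "\<not> ?thesis"
  then have lt: "xs ! (k - 1) < \<theta>" by (simp add: xs_def not_le)
  have "sorted_wrt (\<ge>) xs"
    by (simp add: xs_def sorted_wrt_rev)
  then have "i < k - 1" if "i < length xs" "\<theta> \<le> xs ! i" for i
    using lt that sorted_wrt_nth_less[of "(\<ge>)" xs "k - 1" i]
    by (metis leD linorder_neqE_nat order.trans)
  then have "{i. i < length xs \<and> \<theta> \<le> xs ! i} \<subseteq> {..<k - 1}" by auto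
  then have "card {i. i < length xs \<and> \<theta> \<le> xs ! i} \<le> k - 1"
    using card_mono[OF finite_lessThan] by fastforce
  moreover have "size {#x \<in># M. \<theta> \<le> x#} = card {i. i < length xs \<and> \<theta> \<le> xs ! i}"
    unfolding mset[symmetric] mset_filter[symmetric]
    by (simp add: length_filter_conv_card del: mset_filter)
  ultimately show False using assms by simp
qed

section \<open>Eigenvalues from separated dense vertex sets\<close>

text \<open>
  For a vector that takes the constant value \<open>c j\<close> on each block \<open>C j\<close>, the product of the entries
  at \<open>u\<close> and \<open>v\<close> has no mixed terms when \<open>u\<close> and \<open>v\<close> cannot lie in two different blocks.  This
  applies to \<open>u = v\<close> for disjoint blocks and to adjacent \<open>u\<close> and \<open>v\<close> for separated ones, so both
  quadratic forms of interest become diagonal in \<open>c\<close>.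
\<close>

lemma prod_of_blockwise_constant_sums:
  fixes c :: "nat \<Rightarrow> real" and C :: "nat \<Rightarrow> 'a set"
  assumes unique: "\<And>j l. j < k \<Longrightarrow> l < k \<Longrightarrow> u \<in> C j \<Longrightarrow> v \<in> C l \<Longrightarrow> j = l"
  shows "(\<Sum>j<k. of_bool (u \<in> C j) * c j) * (\<Sum>j<k. of_bool (v \<in> C j) * c j)
    = (\<Sum>j<k. (c j)\<^sup>2 * of_bool (u \<in> C j \<and> v \<in> C j))"
  unfolding sum_product
proof (intro sum.cong refl)
  fix j assume "j \<in> {..<k}"
  then have "(\<Sum>l<k. of_bool (u \<in> C j) * c j * (of_bool (v \<in> C l) * c l))
      = (\<Sum>l<k. if l = j then (c j)\<^sup>2 * of_bool (u \<in> C j \<and> v \<in> C j) else 0)"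
    using unique by (intro sum.cong) (auto simp: power2_eq_square of_bool_def)
  then show "(\<Sum>l<k. of_bool (u \<in> C j) * c j * (of_bool (v \<in> C l) * c l))
      = (c j)\<^sup>2 * of_bool (u \<in> C j \<and> v \<in> C j)"
    using \<open>j \<in> {..<k}\<close> by simp
qed

text \<open>
  An undirected edge inside \<open>A \<inter> B\<close> is counted twice, once per orientation.  In particular
  \<open>arcs_between E A A\<close> is twice the number of edges induced by \<open>A\<close>, so its quotient by \<open>card A\<close> is
  the average degree of the induced subgraph.
\<close>

definition arcs_between :: "('a \<times> 'a) set \<Rightarrow> 'a set \<Rightarrow> 'a set \<Rightarrow> nat" where
  "arcs_between E A B = card (E \<inter> A \<times> B)"

text \<open>
  The indicator vectors of the sets span a space of dimension \<open>card \<C>\<close>.  Since no arc joins two of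
  the sets, the quadratic form of the adjacency matrix splits on this space into the contributions
  of the single sets, so its Rayleigh quotient is a weighted mean of the average degrees inside the
  sets.  This replaces the usual passage through interlacing and the largest eigenvalues of the
  components.
\<close>

lemma eigenvalue_nth_ge_of_separated_sets:
  fixes G :: "'a pair_pre_digraph" and \<theta> :: real
  assumes "pair_graph G" and "finite \<C>" and "\<C> \<noteq> {}"
    and sub: "\<And>C. C \<in> \<C> \<Longrightarrow> C \<subseteq> pverts G" and ne: "\<And>C. C \<in> \<C> \<Longrightarrow> C \<noteq> {}"
    and disj: "\<And>C C' v. C \<in> \<C> \<Longrightarrow> C' \<in> \<C> \<Longrightarrow> v \<in> C \<Longrightarrow> v \<in> C' \<Longrightarrow> C = C'"
    and sep: "\<And>C C' u v. C \<in> \<C> \<Longrightarrow> C' \<in> \<C> \<Longrightarrow> u \<in> C \<Longrightarrow> v \<in> C' \<Longrightarrow> (u, v) \<in> parcs G \<Longrightarrow> C = C'"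
    and dense: "\<And>C. C \<in> \<C> \<Longrightarrow> \<theta> * real (card C) \<le> real (arcs_between (parcs G) C C)"
  shows "\<theta> \<le> eigenvalue_nth G (card \<C>)"
proof -
  interpret pair_graph G by fact
  let ?V = "pverts G" and ?E = "parcs G"
  define k where "k = card \<C>"
  obtain C where bij: "bij_betw C {..<k} \<C>"
    using ex_bij_betw_nat_finite[OF \<open>finite \<C>\<close>] unfolding k_def lessThan_atLeast0 by blast
  have C: "C j \<in> \<C>" if "j < k" for j
    using bij that by (auto dest: bij_betwE)
  have C_inj: "j = l" if "C j = C l" "j < k" "l < k" for j l
    using inj_onD[OF bij_betw_imp_inj_on[OF bij] that(1)] that by simp
  have fin: "finite (C j)" if "j < k" for j
    using sub[OF C[OF that]] finite_verts finite_subset by blast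
  define vs where "vs = (SOME vs. distinct vs \<and> set vs = ?V)"
  have vs: "distinct vs \<and> set vs = ?V"
    unfolding vs_def by (rule someI_ex) (use finite_distinct_list[OF finite_verts] in blast)
  define n where "n = length vs"
  have bij_vs: "bij_betw (\<lambda>i. vs ! i) {..<n} ?V"
    using bij_betw_nth[of vs] vs by (auto simp: n_def)
  have reindex: "(\<Sum>i<n. h (vs ! i)) = (\<Sum>v\<in>?V. h v)" for h :: "'a \<Rightarrow> real"
    by (rule sum.reindex_bij_betw[OF bij_vs])
  define A where "A = adjacency_matrix vs G"
  have A: "A \<in> carrier_mat n n" by (simp add: A_def adjacency_matrix_def n_def)
  have A_sym: "transpose_mat A = A"
    by (rule eq_matI) (auto simp: A_def adjacency_matrix_def dest: graph_symmetric)
  define W :: "real mat" where "W = mat n k (\<lambda>(i, j). of_bool (vs ! i \<in> C j))"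
  have W: "W \<in> carrier_mat n k" by (simp add: W_def)
  define f where "f c v = (\<Sum>j<k. of_bool (v \<in> C j) * c $ j)" for c :: "real vec" and v
  have Wc: "(W *\<^sub>v c) $ i = f c (vs ! i)" if "c \<in> carrier_vec k" "i < n" for c i
    using that W by (simp add: f_def scalar_prod_def W_def lessThan_atLeast0)
  have f_arc: "f c u * f c v = (\<Sum>j<k. (c $ j)\<^sup>2 * of_bool (u \<in> C j \<and> v \<in> C j))"
    if "u = v \<or> (u, v) \<in> ?E" for c u v
    unfolding f_def using that disj sep C C_inj
    by (intro prod_of_blockwise_constant_sums) metis
  have norm: "(W *\<^sub>v c) \<bullet> (W *\<^sub>v c) = (\<Sum>j<k. (c $ j)\<^sup>2 * real (card (C j)))"
    if c: "c \<in> carrier_vec k" for c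
  proof -
    have "(W *\<^sub>v c) \<bullet> (W *\<^sub>v c) = (\<Sum>i<n. f c (vs ! i) * f c (vs ! i))"
      using W Wc[OF c] by (simp add: scalar_prod_def lessThan_atLeast0)
    also have "\<dots> = (\<Sum>v\<in>?V. f c v * f c v)" by (rule reindex)
    also have "\<dots> = (\<Sum>v\<in>?V. \<Sum>j<k. (c $ j)\<^sup>2 * of_bool (v \<in> C j))"
      by (simp add: f_arc)
    also have "\<dots> = (\<Sum>j<k. (c $ j)\<^sup>2 * (\<Sum>v\<in>?V. of_bool (v \<in> C j)))"
      unfolding sum_distrib_left by (rule sum.swap)
    also have "\<dots> = (\<Sum>j<k. (c $ j)\<^sup>2 * real (card (C j)))"
      using sub[OF C] by (intro sum.cong) (auto simp: Int_absorb1)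
    finally show ?thesis .
  qed
  have quad: "(W *\<^sub>v c) \<bullet> (A *\<^sub>v (W *\<^sub>v c))
      = (\<Sum>j<k. (c $ j)\<^sup>2 * real (arcs_between ?E (C j) (C j)))"
    if c: "c \<in> carrier_vec k" for c
  proof -
    have "(A *\<^sub>v (W *\<^sub>v c)) $ i = (\<Sum>v\<in>?V. of_bool ((vs ! i, v) \<in> ?E) * f c v)" if "i < n" for i
    proof -
      have "(A *\<^sub>v (W *\<^sub>v c)) $ i = (\<Sum>j<n. of_bool ((vs ! i, vs ! j) \<in> ?E) * f c (vs ! j))"
        using that A W Wc[OF c]
        by (simp add: scalar_prod_def lessThan_atLeast0 A_def adjacency_matrix_def n_def of_bool_def)
      then show ?thesis
        using reindex[of "\<lambda>v. of_bool ((vs ! i, v) \<in> ?E) * f c v"] by simp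
    qed
    then have "(W *\<^sub>v c) \<bullet> (A *\<^sub>v (W *\<^sub>v c))
        = (\<Sum>i<n. f c (vs ! i) * (\<Sum>v\<in>?V. of_bool ((vs ! i, v) \<in> ?E) * f c v))"
      using A W Wc[OF c] by (simp add: scalar_prod_def lessThan_atLeast0)
    also have "\<dots> = (\<Sum>u\<in>?V. f c u * (\<Sum>v\<in>?V. of_bool ((u, v) \<in> ?E) * f c v))"
      by (rule reindex)
    also have "\<dots> = (\<Sum>u\<in>?V. \<Sum>v\<in>?V. of_bool ((u, v) \<in> ?E) * (f c u * f c v))"
      unfolding sum_distrib_left by (simp only: mult_ac)
    also have "\<dots> = (\<Sum>p\<in>?V \<times> ?V. of_bool (p \<in> ?E) * (f c (fst p) * f c (snd p)))"
      by (simp only: sum.cartesian_product case_prod_unfold prod.collapse)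
    also have "\<dots> = (\<Sum>p\<in>?V \<times> ?V. \<Sum>j<k. (c $ j)\<^sup>2 * of_bool (p \<in> ?E \<inter> C j \<times> C j))"
    proof (intro sum.cong refl)
      fix p assume "p \<in> ?V \<times> ?V"
      show "of_bool (p \<in> ?E) * (f c (fst p) * f c (snd p))
          = (\<Sum>j<k. (c $ j)\<^sup>2 * of_bool (p \<in> ?E \<inter> C j \<times> C j))"
        by (cases p) (auto simp: f_arc)
    qed
    also have "\<dots> = (\<Sum>j<k. (c $ j)\<^sup>2 * (\<Sum>p\<in>?V \<times> ?V. of_bool (p \<in> ?E \<inter> C j \<times> C j)))"
      unfolding sum_distrib_left by (rule sum.swap)
    also have "\<dots> = (\<Sum>j<k. (c $ j)\<^sup>2 * real (arcs_between ?E (C j) (C j)))"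
    proof (intro sum.cong refl)
      fix j assume "j \<in> {..<k}"
      then have "?V \<times> ?V \<inter> {p. p \<in> ?E \<inter> C j \<times> C j} = ?E \<inter> C j \<times> C j"
        using sub[OF C] by blast
      then show "(c $ j)\<^sup>2 * (\<Sum>p\<in>?V \<times> ?V. of_bool (p \<in> ?E \<inter> C j \<times> C j))
          = (c $ j)\<^sup>2 * real (arcs_between ?E (C j) (C j))"
        unfolding arcs_between_def using finite_verts by (subst sum_of_bool_eq) auto
    qed
    finally show ?thesis .
  qed
  have "k \<le> size {#x \<in># proots (char_poly A). \<theta> \<le> x#}"
  proof (rule count_eigenvalues_ge[OF A A_sym W])
    fix c :: "real vec" assume c: "c \<in> carrier_vec k" "c \<noteq> 0\<^sub>v k"
    then obtain j where j: "j < k" "c $ j \<noteq> 0"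
      by (metis carrier_vecD eq_vecI index_zero_vec)
    then have "0 < (c $ j)\<^sup>2 * real (card (C j))"
      using ne[OF C] fin by (simp add: card_gt_0_iff)
    also have "\<dots> \<le> (\<Sum>j<k. (c $ j)\<^sup>2 * real (card (C j)))"
      using j by (intro member_le_sum) auto
    finally have "(W *\<^sub>v c) \<bullet> (W *\<^sub>v c) > 0" using norm[OF c(1)] by simp
    then show "W *\<^sub>v c \<noteq> 0\<^sub>v n" by auto
  next
    fix c :: "real vec" assume c: "c \<in> carrier_vec k"
    show "\<theta> * ((W *\<^sub>v c) \<bullet> (W *\<^sub>v c)) \<le> (W *\<^sub>v c) \<bullet> (A *\<^sub>v (W *\<^sub>v c))"
      unfolding norm[OF c] quad[OF c] sum_distrib_left
    proof (intro sum_mono)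
      fix j assume "j \<in> {..<k}"
      then show "\<theta> * ((c $ j)\<^sup>2 * real (card (C j))) \<le> (c $ j)\<^sup>2 * real (arcs_between ?E (C j) (C j))"
        using mult_left_mono[OF dense[OF C], of j "(c $ j)\<^sup>2"] by (simp add: mult_ac)
    qed
  qed
  moreover have "k > 0" using \<open>finite \<C>\<close> \<open>\<C> \<noteq> {}\<close> by (simp add: k_def card_gt_0_iff)
  ultimately show ?thesis
    unfolding eigenvalue_nth_def adjacency_eigenvalues_def vs_def[symmetric] A_def[symmetric]
      k_def[symmetric]
    by (intro nth_rev_sorted_list_of_multiset_ge)
qed

section \<open>Degree counting in regular bipartite graphs\<close>

lemma arcs_between_commute:
  assumes "sym E"
  shows "arcs_between E A B = arcs_between E B A"
  unfolding arcs_between_def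
  by (rule bij_betw_same_card[OF bij_betw_byWitness[where f = prod.swap and f' = prod.swap]])
    (use assms in \<open>auto dest: symD\<close>)

lemma arcs_between_Un_right:
  assumes "finite E" "B \<inter> B' = {}"
  shows "arcs_between E A (B \<union> B') = arcs_between E A B + arcs_between E A B'"
  unfolding arcs_between_def using assms
  by (subst card_Un_disjoint[symmetric]) (auto intro!: arg_cong[of _ _ card])

lemma arcs_between_Un_left:
  assumes "finite E" "A \<inter> A' = {}"
  shows "arcs_between E (A \<union> A') B = arcs_between E A B + arcs_between E A' B"
  unfolding arcs_between_def using assms
  by (subst card_Un_disjoint[symmetric]) (auto intro!: arg_cong[of _ _ card])

locale regular_arcs =
  fixes V :: "'a set" and E :: "('a \<times> 'a) set" and d :: nat
  assumes finite_V: "finite V" and arcs_in: "E \<subseteq> V \<times> V" and sym_E: "sym E"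
    and degree: "\<And>v. v \<in> V \<Longrightarrow> card {e \<in> E. fst e = v} = d"
begin

lemma finite_E: "finite E"
  using finite_V arcs_in finite_subset by blast

lemma degree_sum:
  assumes "A \<subseteq> V"
  shows "arcs_between E A V = d * card A"
proof -
  have "E \<inter> A \<times> V = (\<Union>v\<in>A. {e \<in> E. fst e = v})"
    using arcs_in by auto
  then have "arcs_between E A V = (\<Sum>v\<in>A. card {e \<in> E. fst e = v})"
    unfolding arcs_between_def using finite_E finite_subset[OF assms finite_V]
    by (simp only:) (subst card_UN_disjoint; auto)
  also have "\<dots> = d * card A"
    using degree assms by (simp add: subset_iff)
  finally show ?thesis .
qed

lemma degree_sum_split:
  assumes "A \<subseteq> V" and "B \<subseteq> V"
  shows "arcs_between E A B + arcs_between E A (V - B) = d * card A"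
  using arcs_between_Un_right[OF finite_E, of B "V - B" A] degree_sum[OF assms(1)] assms(2)
  by (simp add: Un_absorb1)

lemma bipartite_parts_balanced:
  assumes "X \<union> Y = V" and "X \<inter> Y = {}" and "E \<subseteq> X \<times> Y \<union> Y \<times> X" and "d > 0"
  shows "card X = card Y"
proof -
  have "E \<inter> X \<times> V = E \<inter> X \<times> Y" "E \<inter> Y \<times> V = E \<inter> Y \<times> X"
    using assms by auto
  then have "d * card X = d * card Y"
    using degree_sum[of X] degree_sum[of Y] arcs_between_commute[OF sym_E, of X Y] assms(1)
    by (auto simp: arcs_between_def)
  with assms show ?thesis by simp
qed

text \<open>
  Let \<open>A\<close> and \<open>B\<close> be the two sides of \<open>C\<close>, joined by \<open>m\<close> edges and sending \<open>s\<close> and \<open>t\<close> edges out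
  of \<open>C\<close>.  Then \<open>m + s = d |A|\<close> and \<open>m + t = d |B|\<close>, and \<open>s + t < d\<close> forces \<open>|A| = |B| = a\<close> and
  \<open>s = t\<close>.  As \<open>m \<le> a\<^sup>2\<close>, we get \<open>s \<ge> a (d - a)\<close>, which is at least \<open>d - 1\<close> for
  \<open>1 \<le> a < d\<close>, too large for \<open>2 s < d\<close>.  Hence \<open>a \<ge> d\<close>.
\<close>

lemma small_boundary_card_ge:
  assumes XY: "X \<union> Y = V" "X \<inter> Y = {}" "E \<subseteq> X \<times> Y \<union> Y \<times> X"
    and C: "C \<subseteq> V" "C \<noteq> {}" and boundary: "arcs_between E C (V - C) < d"
  shows "2 * d \<le> card C"
proof -
  define A where "A = C \<inter> X"
  define B where "B = C \<inter> Y"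
  have AB: "C = A \<union> B" "A \<inter> B = {}" "A \<subseteq> V" "B \<subseteq> V"
    using XY C by (auto simp: A_def B_def)
  have fin: "finite A" "finite B" using AB finite_V finite_subset by blast+
  have inner: "arcs_between E A C = arcs_between E A B" "arcs_between E B C = arcs_between E B A"
    unfolding arcs_between_def using XY by (auto intro!: arg_cong[of _ _ card] simp: A_def B_def)
  define m where "m = arcs_between E A B"
  define s where "s = arcs_between E A (V - C)"
  define t where "t = arcs_between E B (V - C)"
  have A_deg: "m + s = d * card A" and B_deg: "m + t = d * card B"
    using degree_sum_split[of A C] degree_sum_split[of B C] AB C(1) inner
      arcs_between_commute[OF sym_E, of B A] by (simp_all add: m_def s_def t_def)
  have st: "s + t < d"
    using boundary arcs_between_Un_left[OF finite_E AB(2), of "V - C"] AB(1)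
    by (simp add: s_def t_def)
  have m_le: "m \<le> card A * card B"
    unfolding m_def arcs_between_def card_cartesian_product[symmetric]
    using fin by (intro card_mono) auto
  have card_C: "card C = card A + card B"
    using AB fin by (simp add: card_Un_disjoint)
  \<comment> \<open>Unequal sides would make the two degree sums differ by at least \<open>d\<close>, more than the
    boundary allows.\<close>
  have eq: "card A = card B"
  proof (rule linorder_cases[of "card A" "card B"])
    assume "card A < card B"
    then have "d * card A + d \<le> d * card B"
      using mult_le_mono2[of "Suc (card A)" "card B" d] by simp
    with A_deg B_deg st show ?thesis by linarith
  next
    assume "card B < card A"
    then have "d * card B + d \<le> d * card A"
      using mult_le_mono2[of "Suc (card B)" "card A" d] by simp
    with A_deg B_deg st show ?thesis by linarith
  qed
  have "d \<le> card A"
  proof (rule ccontr)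
    assume "\<not> ?thesis"
    then obtain q where q: "d = card A + Suc q" by (metis add_Suc_right less_imp_Suc_add not_le)
    have "card A > 0" using eq card_C C(2) finite_subset[OF C(1) finite_V] by (metis add_is_0 card_eq_0_iff gr0I)
    then obtain p where p: "card A = Suc p" by (metis gr0_implies_Suc)
    have "card A * Suc q \<le> s"
      using A_deg m_le eq q by (simp add: algebra_simps)
    moreover have "s = t" using A_deg B_deg eq by simp
    ultimately have "2 * (card A * Suc q) < card A + Suc q" using st q by linarith
    then show False unfolding p by (simp add: algebra_simps)
  qed
  then show ?thesis using eq card_C by simp
qed

text \<open>
  All arcs leaving the members of \<open>\<C>\<close> end in \<open>S\<close>, so at most \<open>d (card \<C> - 1)\<close> of them exist:
  compared with \<open>d\<close> arcs per member, at least \<open>d\<close> arcs are missing in total.  Only members with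
  boundary below \<open>d\<close> contribute to the deficit, each at most \<open>d - \<kappa>\<close>.
\<close>

lemma many_small_boundaries:
  assumes "S \<subseteq> V" and "finite \<C>" and sub: "\<And>C. C \<in> \<C> \<Longrightarrow> C \<subseteq> V"
    and disj: "\<And>C C' v. C \<in> \<C> \<Longrightarrow> C' \<in> \<C> \<Longrightarrow> v \<in> C \<Longrightarrow> v \<in> C' \<Longrightarrow> C = C'"
    and into_S: "\<And>C. C \<in> \<C> \<Longrightarrow> E \<inter> C \<times> (V - C) \<subseteq> C \<times> S"
    and cut: "\<And>C. C \<in> \<C> \<Longrightarrow> \<kappa> \<le> arcs_between E C (V - C)"
    and "\<kappa> \<le> d" and "card S < card \<C>"
  shows "d \<le> (d - \<kappa>) * card {C \<in> \<C>. arcs_between E C (V - C) < d}"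
proof -
  let ?R = "{C \<in> \<C>. arcs_between E C (V - C) < d}"
  have "(\<Sum>C\<in>\<C>. arcs_between E C (V - C)) = card (\<Union>C\<in>\<C>. E \<inter> C \<times> (V - C))"
    unfolding arcs_between_def using \<open>finite \<C>\<close> finite_E disj
    by (subst card_UN_disjoint) auto
  also have "\<dots> \<le> card (E \<inter> V \<times> S)"
    using finite_E into_S sub by (intro card_mono) blast+
  also have "\<dots> = d * card S"
    using degree_sum[OF \<open>S \<subseteq> V\<close>] arcs_between_commute[OF sym_E, of V S]
    by (simp add: arcs_between_def)
  finally have upper: "(\<Sum>C\<in>\<C>. arcs_between E C (V - C)) \<le> d * card S" .
  have "d * card \<C> = (\<Sum>C\<in>\<C>. d)" by simp
  also have "\<dots> \<le> (\<Sum>C\<in>\<C>. arcs_between E C (V - C)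
      + (if arcs_between E C (V - C) < d then d - \<kappa> else 0))"
    using cut \<open>\<kappa> \<le> d\<close> by (intro sum_mono) (auto simp: not_less dest!: cut)
  also have "\<dots> = (\<Sum>C\<in>\<C>. arcs_between E C (V - C)) + (d - \<kappa>) * card ?R"
    using \<open>finite \<C>\<close> by (simp add: sum.distrib sum.If_cases Int_def conj_commute)
  finally have "d * card \<C> \<le> d * card S + (d - \<kappa>) * card ?R" using upper by linarith
  moreover have "d * card S + d \<le> d * card \<C>"
    using \<open>card S < card \<C>\<close> mult_le_mono2[of "Suc (card S)" "card \<C>" d] by simp
  ultimately show ?thesis by linarith
qed

end

section \<open>Edge cuts and components\<close>

lemma regular_arcs_of_regular_graph:
  assumes "pair_graph G" and "regular G d"
  shows "regular_arcs (pverts G) (parcs G) d"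
proof -
  interpret pair_graph G by fact
  show ?thesis
  proof
    show "finite (pverts G)" by (rule finite_verts)
    show "parcs G \<subseteq> pverts G \<times> pverts G" by (auto dest: in_arcsD1 in_arcsD2)
    show "sym (parcs G)" using pair_sym_arcs by (simp add: symmetric_def)
    show "card {e \<in> parcs G. fst e = v} = d" if "v \<in> pverts G" for v
      using assms(2) that by (simp add: regular_def out_degree_def out_arcs_def)
  qed
qed

text \<open>
  The edges leaving \<open>C\<close> form a disconnecting set: once they are removed, no walk that starts in \<open>C\<close>
  can leave \<open>C\<close>.
\<close>

lemma edge_connectivity_le_boundary:
  assumes "pair_graph G" and C: "C \<subseteq> pverts G" "C \<noteq> {}" "C \<noteq> pverts G"
  shows "edge_connectivity G \<le> arcs_between (parcs G) C (pverts G - C)"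
proof -
  interpret pair_graph G by fact
  define B where "B = parcs G \<inter> C \<times> (pverts G - C)"
  define F where "F = (\<lambda>(u, v). {u, v}) ` B"
  have "F \<subseteq> edges G" by (auto simp: F_def B_def edges_def)
  moreover have "\<not> Digraph_Component.connected (with_proj (del_edges G F))"
  proof
    assume conn: "Digraph_Component.connected (with_proj (del_edges G F))"
    let ?H = "mk_symmetric (with_proj (del_edges G F))"
    obtain u v where uv: "u \<in> C" "v \<in> pverts G - C" using C by blast
    have "u \<rightarrow>\<^sup>*\<^bsub>with_proj ?H\<^esub> v"
      using conn C uv unfolding connected_def strongly_connected_def
      by (auto simp: del_edges_def)
    then have "(u, v) \<in> (parcs ?H)\<^sup>*" using reachable_rtranclI by fastforce
    then have "v \<in> C"
    proof induction
      case base
      show ?case by (rule uv(1))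
    next
      case (step x y)
      then have "(x, y) \<in> parcs G" "{x, y} \<notin> F"
        using graph_symmetric
        by (auto simp: parcs_mk_symmetric del_edges_def insert_commute)
      then show ?case using step.IH in_arcsD2 by (force simp: F_def B_def)
    qed
    with uv show False by simp
  qed
  ultimately have "edge_connectivity G \<le> card F"
    unfolding edge_connectivity_def by (intro cInf_lower bdd_below_bot) blast
  also have "\<dots> \<le> card B"
    unfolding F_def B_def using finite_arcs by (intro card_image_le) auto
  finally show ?thesis by (simp add: B_def arcs_between_def)
qed

text \<open>
  Components are defined by strong connectivity, so it is the symmetry of \<open>G\<close> that makes every
  arc leaving a component of \<open>G - S\<close> end in \<open>S\<close>.
\<close>

lemma components_of_vertex_deletion:
  fixes G :: "'a pair_pre_digraph" and S :: "'a set"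
  assumes "pair_graph G"
  defines "\<C> \<equiv> pre_digraph.sccs_verts (with_proj G \<restriction> (pverts G - S))"
  shows "finite \<C>"
    and "C \<in> \<C> \<Longrightarrow> C \<noteq> {} \<and> C \<subseteq> pverts G - S"
    and "C \<in> \<C> \<Longrightarrow> C' \<in> \<C> \<Longrightarrow> v \<in> C \<Longrightarrow> v \<in> C' \<Longrightarrow> C = C'"
    and "C \<in> \<C> \<Longrightarrow> u \<in> C \<Longrightarrow> (u, v) \<in> parcs G \<Longrightarrow> v \<in> pverts G - S \<Longrightarrow> v \<in> C"
proof -
  interpret pair_graph G by fact
  define H where "H = with_proj G \<restriction> (pverts G - S)"
  interpret H: wf_digraph H
    unfolding H_def by (rule wellformed_induce_subgraph)
  have \<C>: "\<C> = H.sccs_verts" by (simp add: \<C>_def H_def)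
  have verts_H: "verts H = pverts G - S" by (simp add: H_def)
  show sub: "C \<noteq> {} \<and> C \<subseteq> pverts G - S" if "C \<in> \<C>" for C
    using that H.sccs_verts_subsets[of C] unfolding \<C> verts_H
    by (auto simp: H.in_sccs_verts_conv_reachable)
  show "finite \<C>"
    using finite_subset[of \<C> "Pow (pverts G - S)"] sub finite_verts by blast
  show "C \<in> \<C> \<Longrightarrow> C' \<in> \<C> \<Longrightarrow> v \<in> C \<Longrightarrow> v \<in> C' \<Longrightarrow> C = C'"
    unfolding \<C> using H.sccs_verts_disjoint by blast
  show "v \<in> C" if C: "C \<in> \<C>" "u \<in> C" and uv: "(u, v) \<in> parcs G" "v \<in> pverts G - S"
  proof (rule ccontr)
    assume "v \<notin> C"
    have u: "u \<in> pverts G - S" using C sub by blast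
    have "u \<rightarrow>\<^bsub>H\<^esub> v" "v \<rightarrow>\<^bsub>H\<^esub> u"
      using u uv graph_symmetric[OF uv(1)]
      by (auto simp: H_def arcs_ends_def arc_to_ends_def)
    then have "u \<rightarrow>\<^sup>*\<^bsub>H\<^esub> v" "v \<rightarrow>\<^sup>*\<^bsub>H\<^esub> u" by auto
    with C \<open>v \<notin> C\<close> show False
      unfolding \<C> H.in_sccs_verts_conv_reachable by blast
  qed
qed

lemma num_components_independent:
  assumes "pair_graph G" and "Y \<subseteq> pverts G" and indep: "parcs G \<inter> Y \<times> Y = {}"
  shows "num_components (with_proj G \<restriction> Y) = card Y"
proof -
  interpret pair_graph G by fact
  define H where "H = with_proj G \<restriction> Y"
  interpret H: wf_digraph H
    unfolding H_def by (rule wellformed_induce_subgraph)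
  have arcs_H: "arcs_ends H = {}"
    using indep by (auto simp: H_def arcs_ends_def arc_to_ends_def)
  have "H.scc_of v = {v}" if "v \<in> Y" for v
  proof -
    have "w = v" if "v \<rightarrow>\<^sup>*\<^bsub>H\<^esub> w" for w
      using reachable_rtranclI[OF that] arcs_H by simp
    moreover have "v \<in> verts H" using that by (simp add: H_def)
    ultimately show ?thesis by (auto simp: H.scc_of_def)
  qed
  then have "H.sccs_verts = (\<lambda>v. {v}) ` Y"
    unfolding H.sccs_verts_conv_scc_of by (simp add: H_def)
  then show ?thesis
    unfolding num_components_def H_def[symmetric] by (simp add: card_image)
qed

section \<open>Toughness\<close>

text \<open>
  The average degree inside \<open>C\<close> is \<open>d - b / card C\<close> for a set with \<open>b\<close> boundary arcs, and here
  \<open>b \<le> d - 1\<close> and \<open>card C \<ge> 2 d\<close>.  This is the origin of the eigenvalue bound.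
\<close>

lemma (in regular_arcs) average_degree_ge:
  assumes "C \<subseteq> V" and "2 * d \<le> card C" and "d > 0" and "arcs_between E C (V - C) < d"
  shows "(real d - (real d - 1) / (2 * real d)) * real (card C) \<le> real (arcs_between E C C)"
proof -
  have "real (arcs_between E C C) + real (arcs_between E C (V - C)) = real d * real (card C)"
    using degree_sum_split[OF assms(1,1)] by (simp flip: of_nat_add of_nat_mult)
  moreover have "real (arcs_between E C (V - C)) \<le> (real d - 1) * 1"
    using assms by simp
  moreover have "(real d - 1) * 1 \<le> (real d - 1) * (real (card C) / (2 * real d))"
    using assms by (intro mult_left_mono) (auto simp: field_simps)
  ultimately show ?thesis by (simp add: algebra_simps)
qed

lemma eigenvalue_nth_ge_of_small_boundaries:
  assumes "pair_graph G" and "bipartite G" and "regular G d" and "d > 0"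
    and "finite \<C>" and "\<C> \<noteq> {}"
    and sub: "\<And>C. C \<in> \<C> \<Longrightarrow> C \<noteq> {} \<and> C \<subseteq> pverts G"
    and disj: "\<And>C C' v. C \<in> \<C> \<Longrightarrow> C' \<in> \<C> \<Longrightarrow> v \<in> C \<Longrightarrow> v \<in> C' \<Longrightarrow> C = C'"
    and sep: "\<And>C C' u v. C \<in> \<C> \<Longrightarrow> C' \<in> \<C> \<Longrightarrow> u \<in> C \<Longrightarrow> v \<in> C' \<Longrightarrow> (u, v) \<in> parcs G \<Longrightarrow> C = C'"
    and boundary: "\<And>C. C \<in> \<C> \<Longrightarrow> arcs_between (parcs G) C (pverts G - C) < d"
  shows "real d - (real d - 1) / (2 * real d) \<le> eigenvalue_nth G (card \<C>)"
proof (rule eigenvalue_nth_ge_of_separated_sets[OF assms(1,5,6)])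
  interpret regular_arcs "pverts G" "parcs G" d
    using assms(1,3) by (rule regular_arcs_of_regular_graph)
  obtain X Y where XY: "X \<union> Y = pverts G" "X \<inter> Y = {}"
    and arcs: "\<forall>(u, v) \<in> parcs G. (u \<in> X \<and> v \<in> Y) \<or> (u \<in> Y \<and> v \<in> X)"
    using \<open>bipartite G\<close> unfolding bipartite_def by blast
  fix C assume C: "C \<in> \<C>"
  have "parcs G \<subseteq> X \<times> Y \<union> Y \<times> X" using arcs by auto
  then have "2 * d \<le> card C"
    using small_boundary_card_ge[OF XY] sub[OF C] boundary[OF C] by blast
  then show "(real d - (real d - 1) / (2 * real d)) * real (card C)
      \<le> real (arcs_between (parcs G) C C)"
    using sub[OF C] boundary[OF C] \<open>d > 0\<close> by (intro average_degree_ge) auto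
qed (use sub disj sep in blast)+

text \<open>
  If deleting \<open>S\<close> left more than \<open>card S\<close> components, then by the counting argument at least
  \<open>\<lceil>d / (d - \<kappa>')\<rceil>\<close> of them would have a boundary below \<open>d\<close>; these would push that many eigenvalues
  up to the forbidden bound.
\<close>

lemma num_components_le_card:
  assumes G: "pair_graph G" "bipartite G" "regular G d"
    and \<kappa>: "edge_connectivity G < d"
    and eig: "eigenvalue_nth G (nat \<lceil>real d / (real d - real (edge_connectivity G))\<rceil>)
           < real d - (real d - 1) / (2 * real d)"
    and S: "S \<subseteq> pverts G" "num_components (with_proj G \<restriction> (pverts G - S)) > 1"
  shows "num_components (with_proj G \<restriction> (pverts G - S)) \<le> card S"
proof (rule ccontr)
  assume less: "\<not> num_components (with_proj G \<restriction> (pverts G - S)) \<le> card S"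
  interpret regular_arcs "pverts G" "parcs G" d
    using G(1,3) by (rule regular_arcs_of_regular_graph)
  let ?\<kappa> = "edge_connectivity G"
  define \<C> where "\<C> = pre_digraph.sccs_verts (with_proj G \<restriction> (pverts G - S))"
  note comps = components_of_vertex_deletion[OF G(1), where S = S, folded \<C>_def]
  have card_\<C>: "card \<C> = num_components (with_proj G \<restriction> (pverts G - S))"
    by (simp add: \<C>_def num_components_def)
  \<comment> \<open>With more than one component each of them is a proper vertex set, so that its boundary is an
    edge cut.\<close>
  have proper: "C \<noteq> pverts G" if "C \<in> \<C>" for C
  proof
    assume "C = pverts G"
    then have "\<C> \<subseteq> {C}" using comps(2,3) that by blast
    then have "card \<C> \<le> 1" using card_mono[of "{C}" \<C>] by simp
    with S(2) card_\<C> show False by simp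
  qed
  define R where "R = {C \<in> \<C>. arcs_between (parcs G) C (pverts G - C) < d}"
  have "d \<le> (d - ?\<kappa>) * card R"
    unfolding R_def
  proof (rule many_small_boundaries[OF S(1) comps(1)])
    show "parcs G \<inter> C \<times> (pverts G - C) \<subseteq> C \<times> S" if "C \<in> \<C>" for C
      using comps(4)[OF that] by blast
    show "?\<kappa> \<le> arcs_between (parcs G) C (pverts G - C)" if "C \<in> \<C>" for C
      using comps(2)[OF that] proper[OF that] by (intro edge_connectivity_le_boundary[OF G(1)]) auto
    show "card S < card \<C>" using less card_\<C> by simp
  qed (use comps \<kappa> in \<open>auto\<close>)
  define k where "k = nat \<lceil>real d / (real d - real ?\<kappa>)\<rceil>"
  have "real d \<le> (real d - real ?\<kappa>) * real (card R)"
    using \<open>d \<le> (d - ?\<kappa>) * card R\<close> \<kappa> by (simp flip: of_nat_mult of_nat_diff)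
  then have "real d / (real d - real ?\<kappa>) \<le> real (card R)"
    using \<kappa> by (simp add: field_simps)
  then have "k \<le> card R" unfolding k_def by (simp add: ceiling_le_iff nat_le_iff)
  have "k > 0" using \<kappa> unfolding k_def by simp
  obtain R' where R': "R' \<subseteq> R" "card R' = k"
    using obtain_subset_with_card_n[OF \<open>k \<le> card R\<close>] by blast
  have "real d - (real d - 1) / (2 * real d) \<le> eigenvalue_nth G (card R')"
  proof (rule eigenvalue_nth_ge_of_small_boundaries[OF G])
    show "finite R'" using R' \<open>k > 0\<close> card_gt_0_iff by blast
    show "R' \<noteq> {}" using R' \<open>k > 0\<close> by auto
    fix C assume "C \<in> R'"
    then have C: "C \<in> \<C>" "arcs_between (parcs G) C (pverts G - C) < d"
      using R' by (auto simp: R_def)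
    then show "arcs_between (parcs G) C (pverts G - C) < d" "C \<noteq> {} \<and> C \<subseteq> pverts G"
      using comps(2) by blast+
    fix C' v assume "C' \<in> R'" "v \<in> C'"
    then have C': "C' \<in> \<C>" using R' by (auto simp: R_def)
    show "v \<in> C \<Longrightarrow> C = C'" using comps(3)[OF C(1) C'] \<open>v \<in> C'\<close> by blast
    show "C = C'" if "u \<in> C" "(u, v) \<in> parcs G" for u
      using comps(2)[OF C'] comps(3)[OF C(1) C'] comps(4)[OF C(1) that] \<open>v \<in> C'\<close> by blast
  qed (use \<kappa> in simp)
  with eig show False by (simp add: R'(2) k_def)
qed

theorem theorem1p11:
  fixes G :: "'a pair_pre_digraph" and d :: nat
  assumes "pair_graph G"
    and "bipartite G"
    and "Digraph_Component.connected (with_proj G)"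
    and "regular G d"
    and "edge_connectivity G < d"
    and "eigenvalue_nth G (nat \<lceil>real d / (real d - real (edge_connectivity G))\<rceil>)
           < real d - (real d - 1) / (2 * real d)"
  shows "toughness G = 1"
proof -
  interpret pair_graph G by fact
  interpret regular_arcs "pverts G" "parcs G" d
    using assms(1,4) by (rule regular_arcs_of_regular_graph)
  have "d > 0" using assms(5) by simp
  have nonempty: "pverts G \<noteq> {}"
    using assms(3) by (simp add: connected_def strongly_connected_def)
  \<comment> \<open>The whole vertex set has no boundary, which gives an eigenvalue at least \<open>1\<close> when \<open>d = 1\<close>;
    the index in the hypothesis is then \<open>1\<close> and the bound is \<open>1\<close> as well.\<close>
  have "d \<noteq> 1"
  proof
    assume "d = 1"
    then have "edge_connectivity G = 0" using assms(5) by simp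
    have "real d - (real d - 1) / (2 * real d) \<le> eigenvalue_nth G (card {pverts G})"
      using nonempty \<open>d > 0\<close>
      by (intro eigenvalue_nth_ge_of_small_boundaries[OF assms(1,2,4)])
        (auto simp: arcs_between_def)
    with assms(6) show False by (simp add: \<open>d = 1\<close> \<open>edge_connectivity G = 0\<close>)
  qed
  obtain X Y where XY: "X \<union> Y = pverts G" "X \<inter> Y = {}"
    and arcs: "\<forall>(u, v) \<in> parcs G. (u \<in> X \<and> v \<in> Y) \<or> (u \<in> Y \<and> v \<in> X)"
    using \<open>bipartite G\<close> unfolding bipartite_def by blast
  have arcs': "parcs G \<subseteq> X \<times> Y \<union> Y \<times> X" using arcs by auto
  have card_eq: "card X = card Y"
    using bipartite_parts_balanced[OF XY arcs' \<open>d > 0\<close>] .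
  have "2 * d \<le> card (pverts G)"
    using small_boundary_card_ge[OF XY arcs' order_refl nonempty] \<open>d > 0\<close>
    by (simp add: arcs_between_def)
  also have "\<dots> = card X + card Y"
    using XY finite_verts by (metis card_Un_disjoint finite_Un)
  finally have card_Y: "card Y > 1" using \<open>d > 0\<close> \<open>d \<noteq> 1\<close> card_eq by simp
  \<comment> \<open>Deleting one colour class leaves the isolated vertices of the other, equally large one, so the
    toughness is at most \<open>1\<close>.\<close>
  have "pverts G - X = Y" using XY by blast
  moreover have "parcs G \<inter> Y \<times> Y = {}" using arcs' XY by blast
  ultimately have comps_X: "num_components (with_proj G \<restriction> (pverts G - X)) = card Y"
    using num_components_independent[OF assms(1), of Y] XY by auto
  let ?T = "{real (card S) / real (num_components (with_proj G \<restriction> (pverts G - S))) | S.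
            S \<subset> pverts G \<and> num_components (with_proj G \<restriction> (pverts G - S)) > 1}"
  have "Y \<noteq> {}" using card_Y by auto
  then have "X \<subset> pverts G" using XY by blast
  then have one: "1 \<in> ?T"
    using comps_X card_Y card_eq by (intro CollectI exI[of _ X]) auto
  have lower: "1 \<le> t" if t: "t \<in> ?T" for t
  proof -
    from t obtain S where t_eq: "t = real (card S) / real (num_components (with_proj G \<restriction> (pverts G - S)))"
      and S: "S \<subset> pverts G" "num_components (with_proj G \<restriction> (pverts G - S)) > 1"
      by blast
    have "num_components (with_proj G \<restriction> (pverts G - S)) \<le> card S"
      using S by (intro num_components_le_card[OF assms(1,2,4,5,6)]) auto
    then show ?thesis using S(2) unfolding t_eq by simp
  qed
  have "finite ?T"
    by (rule finite_subset[of _ "(\<lambda>S. real (card S) / real (num_components (with_proj G \<restriction> (pverts G - S)))) ` Pow (pverts G)"])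
      (use finite_verts in auto)
  then show ?thesis
    unfolding toughness_def by (intro Min_eqI lower one)
qed

end
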